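(* Let $\Gamma$ be a finite quiver. A basis of the Lie algebra $\mathrm{Der}(\mathbf{k}\Gamma)$ is given by the set $\mathfrak{B}:=\mathfrak{B}_1\cup\mathfrak{B}_2$, where $$\mathfrak{B}_1:=\{D_s\mid s\in\mathcal{P}_A\},\qquad \mathfrak{B}_2:=\{D_{r,s}\mid r\in E,\ s\in\mathcal{P},\ s\parallel r\}.$$ Thus $\mathrm{Der}(\mathbf{k}\Gamma)=\mathfrak{D}_1\oplus\mathfrak{D}_2$ (as vector spaces), where $\mathfrak{D}_i$ is the $\mathbf{k}$-linear space with basis $\mathfrak{B}_i$ for $i=1,2$.
   Context: $\mathbf{k}$ is a field. A quiver $\Gamma=(V,E,t,h)$ consists of a set $V$ of vertices, a set $E$ of arrows and maps $t,h:E\to V$ (tail and head); it is finite if $V$ and $E$ are finite. A path of length $\ell\ge0$ is $p=v_0p_1v_1\cdots p_\ell v_\ell$ with $p_j\in E$, $t(p_j)=v_{j-1}$, $h(p_j)=v_j$; $t(p)=v_0$, $h(p)=v_\ell$; vertices are the paths of length $0$. $\mathcal{P}$ is the set of all paths. The path algebra $\mathbf{k}\Gamma$ has basis $\mathcal{P}$, with product of $p,q\in\mathcal{P}$ the concatenation $pq$ if $h(p)=t(q)$ and $0$ otherwise. $p\parallel q$ means $t(p)=t(q)$ and $h(p)=h(q)$. $\mathcal{P}_A=\{p\in\mathcal{P}:h(p)\neq t(p)\}$. $\mathrm{Der}(A)$ is the Lie algebra of derivations of $A$ ($\mathbf{k}$-linear maps with $D(xy)=D(x)y+xD(y)$) under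 the commutator. For $s\in\mathcal{P}$, $D_s$ is the inner derivation $D_s(b)=sb-bs$. For $r\in E$ and $s\parallel r$, $D_{r,s}:\mathbf{k}\Gamma\to\mathbf{k}\Gamma$ is the linear operator defined on paths by $D_{r,s}(v)=0$ for $v\in V$ and recursively, for $p=p_1\tilde p$ with $p_1\in E$ and $\tilde p\in\mathcal{P}$, $D_{r,s}(p)=s\tilde p+p_1D_{r,s}(\tilde p)$ if $p_1=r$ and $D_{r,s}(p)=p_1D_{r,s}(\tilde p)$ if $p_1\ne r$ (it is a derivation). *)

theory Defs
  imports
    "Graph_Theory.Arc_Walk"
    "HOL-Library.Poly_Mapping"
    "HOL-Library.Function_Algebras"
begin

section \<open>Paths\<close>

text \<open>A quiver is a \<^locale>\<open>wf_digraph\<close> (loops and parallel arrows are allowed there), a finite quiver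
  is a \<^locale>\<open>fin_digraph\<close>. A path is encoded by its tail together with its list of arrows;
  the tail distinguishes the paths \<open>(v, [])\<close> of length 0, i.e. the vertices.\<close>

type_synonym ('v, 'e) path = "'v \<times> 'e list"

definition paths :: "('v, 'e) pre_digraph \<Rightarrow> ('v, 'e) path set" where
  "paths G = {(u, es) | u es. \<exists>v. pre_digraph.awalk G u es v}"

definition ptail :: "('v, 'e) path \<Rightarrow> 'v" where
  "ptail p = fst p"

definition phead :: "('v, 'e) pre_digraph \<Rightarrow> ('v, 'e) path \<Rightarrow> 'v" where
  "phead G p = pre_digraph.awlast G (fst p) (snd p)"

definition arrow_path :: "('v, 'e) pre_digraph \<Rightarrow> 'e \<Rightarrow> ('v, 'e) path" where
  "arrow_path G e = (tail G e, [e])"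

definition parallel_paths :: "('v, 'e) pre_digraph \<Rightarrow> ('v, 'e) path \<Rightarrow> ('v, 'e) path \<Rightarrow> bool" where
  "parallel_paths G p q \<longleftrightarrow> ptail p = ptail q \<and> phead G p = phead G q"

definition nonclosed_paths :: "('v, 'e) pre_digraph \<Rightarrow> ('v, 'e) path set" where
  "nonclosed_paths G = {p \<in> paths G. phead G p \<noteq> ptail p}"

section \<open>The path algebra\<close>

text \<open>Elements are finitely supported functions. The type allows arbitrary pairs in the support,
  so the path algebra of \<open>G\<close> is the carrier set of those supported on the paths of \<open>G\<close>.\<close>

type_synonym ('v, 'e, 'k) path_alg = "('v, 'e) path \<Rightarrow>\<^sub>0 'k"

definition path_algebra :: "('v, 'e) pre_digraph \<Rightarrow> ('v, 'e, 'k::field) path_alg set" where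
  "path_algebra G = {x. Poly_Mapping.keys x \<subseteq> paths G}"

definition pscale :: "'k::field \<Rightarrow> ('v, 'e, 'k) path_alg \<Rightarrow> ('v, 'e, 'k) path_alg" where
  "pscale c x = Poly_Mapping.map ((*) c) x"

definition pbasis :: "('v, 'e) path \<Rightarrow> ('v, 'e, 'k::field) path_alg" where
  "pbasis p = Poly_Mapping.single p 1"

definition path_mult :: "('v, 'e) pre_digraph \<Rightarrow> ('v, 'e) path \<Rightarrow> ('v, 'e) path \<Rightarrow> ('v, 'e, 'k::field) path_alg" where
  "path_mult G p q = (if phead G p = ptail q then pbasis (ptail p, snd p @ snd q) else 0)"

definition pmult :: "('v, 'e) pre_digraph \<Rightarrow> ('v, 'e, 'k::field) path_alg
    \<Rightarrow> ('v, 'e, 'k) path_alg \<Rightarrow> ('v, 'e, 'k) path_alg" where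
  "pmult G x y = (\<Sum>p\<in>Poly_Mapping.keys x. \<Sum>q\<in>Poly_Mapping.keys y.
     pscale (Poly_Mapping.lookup x p * Poly_Mapping.lookup y q) (path_mult G p q))"

section \<open>Operators and derivations\<close>

text \<open>Linear operators on the path algebra of \<open>G\<close> are represented by functions that vanish outside
  the carrier set. This makes equality of functions coincide with equality of operators, and the
  vector space operations are the pointwise ones.\<close>

type_synonym ('v, 'e, 'k) path_op = "('v, 'e, 'k) path_alg \<Rightarrow> ('v, 'e, 'k) path_alg"

definition op_scale :: "'k::field \<Rightarrow> ('v, 'e, 'k) path_op \<Rightarrow> ('v, 'e, 'k) path_op" where
  "op_scale c D = (\<lambda>x. pscale c (D x))"

lemma lookup_pscale [simp]: "Poly_Mapping.lookup (pscale c x) p = c * Poly_Mapping.lookup x p"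
  by (simp add: pscale_def Poly_Mapping.map.rep_eq when_def)

global_interpretation pa: vector_space "pscale :: 'k::field \<Rightarrow> ('v, 'e, 'k) path_alg \<Rightarrow> _"
  by unfold_locales (auto intro!: poly_mapping_eqI simp: lookup_add algebra_simps)

global_interpretation op: vector_space "op_scale :: 'k::field \<Rightarrow> ('v, 'e, 'k) path_op \<Rightarrow> _"
  by unfold_locales
    (auto simp: op_scale_def fun_eq_iff pa.scale_right_distrib pa.scale_left_distrib)

definition derivations :: "('v, 'e) pre_digraph \<Rightarrow> ('v, 'e, 'k::field) path_op set" where
  "derivations G = {D.
     (\<forall>x\<in>path_algebra G. D x \<in> path_algebra G) \<and>
     (\<forall>x. x \<notin> path_algebra G \<longrightarrow> D x = 0) \<and>
     (\<forall>x\<in>path_algebra G. \<forall>y\<in>path_algebra G. D (x + y) = D x + D y) \<and>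
     (\<forall>c. \<forall>x\<in>path_algebra G. D (pscale c x) = pscale c (D x)) \<and>
     (\<forall>x\<in>path_algebra G. \<forall>y\<in>path_algebra G.
        D (pmult G x y) = pmult G (D x) y + pmult G x (D y))}"

definition inner_der :: "('v, 'e) pre_digraph \<Rightarrow> ('v, 'e) path \<Rightarrow> ('v, 'e, 'k::field) path_op" where
  "inner_der G s b = (if b \<in> path_algebra G
     then pmult G (pbasis s) b - pmult G b (pbasis s) else 0)"

text \<open>The value of \<open>D\<^bsub>r,s\<^esub>\<close> on the path with tail \<open>u\<close> and arrow list \<open>es\<close>.\<close>

primrec arrow_der_path :: "('v, 'e) pre_digraph \<Rightarrow> 'e \<Rightarrow> ('v, 'e) path \<Rightarrow> 'v \<Rightarrow> 'e list
    \<Rightarrow> ('v, 'e, 'k::field) path_alg" where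
  "arrow_der_path G r s u [] = 0"
| "arrow_der_path G r s u (e # es) =
     (if e = r
      then pmult G (pbasis s) (pbasis (head G e, es))
         + pmult G (pbasis (arrow_path G e)) (arrow_der_path G r s (head G e) es)
      else pmult G (pbasis (arrow_path G e)) (arrow_der_path G r s (head G e) es))"

definition arrow_der :: "('v, 'e) pre_digraph \<Rightarrow> 'e \<Rightarrow> ('v, 'e) path \<Rightarrow> ('v, 'e, 'k::field) path_op" where
  "arrow_der G r s x = (if x \<in> path_algebra G
     then \<Sum>p\<in>Poly_Mapping.keys x.
       pscale (Poly_Mapping.lookup x p) (arrow_der_path G r s (fst p) (snd p))
     else 0)"

definition der_basis1 :: "('v, 'e) pre_digraph \<Rightarrow> ('v, 'e, 'k::field) path_op set" where
  "der_basis1 G = {inner_der G s | s. s \<in> nonclosed_paths G}"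

definition der_basis2 :: "('v, 'e) pre_digraph \<Rightarrow> ('v, 'e, 'k::field) path_op set" where
  "der_basis2 G = {arrow_der G r s | r s.
     r \<in> arcs G \<and> s \<in> paths G \<and> parallel_paths G s (arrow_path G r)}"

definition is_basis_of :: "('v, 'e, 'k::field) path_op set \<Rightarrow> ('v, 'e, 'k) path_op set \<Rightarrow> bool" where
  "is_basis_of B S \<longleftrightarrow> op.independent B \<and> op.span B = S"

definition is_direct_sum :: "('v, 'e, 'k::field) path_op set \<Rightarrow> ('v, 'e, 'k) path_op set
    \<Rightarrow> ('v, 'e, 'k) path_op set \<Rightarrow> bool" where
  "is_direct_sum S S1 S2 \<longleftrightarrow> op.subspace S1 \<and> op.subspace S2 \<and>
     S = {D1 + D2 | D1 D2. D1 \<in> S1 \<and> D2 \<in> S2} \<and> S1 \<inter> S2 = {0}"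

section \<open>The Lie algebra structure on the derivations\<close>

definition commutator :: "('v, 'e, 'k::field) path_op \<Rightarrow> ('v, 'e, 'k) path_op \<Rightarrow> ('v, 'e, 'k) path_op" where
  "commutator D D' = D \<circ> D' - D' \<circ> D"

lemma path_algebra_zero [simp]: "0 \<in> path_algebra G"
  by (simp add: path_algebra_def)

lemma path_algebra_add:
  "x \<in> path_algebra G \<Longrightarrow> y \<in> path_algebra G \<Longrightarrow> x + y \<in> path_algebra G"
  using keys_add[of x y] by (auto simp: path_algebra_def)

lemma path_algebra_pscale: "x \<in> path_algebra G \<Longrightarrow> pscale c x \<in> path_algebra G"
  by (auto simp: path_algebra_def in_keys_iff)

lemma path_algebra_diff:
  "x \<in> path_algebra G \<Longrightarrow> y \<in> path_algebra G \<Longrightarrow> x - y \<in> path_algebra G"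
  using path_algebra_add[of x G "pscale (-1) y"] path_algebra_pscale[of y G "-1"] by simp

lemma path_algebra_sum:
  "(\<And>i. i \<in> I \<Longrightarrow> f i \<in> path_algebra G) \<Longrightarrow> sum f I \<in> path_algebra G"
  by (induction I rule: infinite_finite_induct) (auto intro: path_algebra_add)

lemma path_mult_in:
  assumes "p \<in> paths G" "q \<in> paths G"
  shows "path_mult G p q \<in> path_algebra G"
proof (cases "phead G p = ptail q")
  case True
  obtain u es v w fs where p: "p = (u, es)" "q = (w, fs)" by (cases p, cases q) auto
  from assms p obtain a b where ab: "pre_digraph.awalk G u es a" "pre_digraph.awalk G w fs b"
    by (auto simp: paths_def)
  have cas_awlast: "pre_digraph.cas G u' es' a' \<Longrightarrow> pre_digraph.awlast G u' es' = a'" for u' es' a'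
    by (induction es' arbitrary: u')
      (auto simp: pre_digraph.cas.simps pre_digraph.awalk_verts.simps pre_digraph.awalk_verts_conv)
  have aw: "a = w" using ab(1) True p
    by (auto simp: phead_def ptail_def pre_digraph.awalk_def dest: cas_awlast)
  have cas_app: "pre_digraph.cas G u' es' w \<Longrightarrow> pre_digraph.cas G u' (es' @ fs) b" for u' es'
    using ab(2)
    by (induction es' arbitrary: u') (auto simp: pre_digraph.cas.simps pre_digraph.awalk_def)
  have "pre_digraph.awalk G u (es @ fs) b"
    using ab aw cas_app by (auto simp: pre_digraph.awalk_def)
  then show ?thesis
    using True p by (auto simp: path_mult_def pbasis_def path_algebra_def paths_def ptail_def)
qed (simp add: path_mult_def)

lemma path_algebra_pmult:
  "x \<in> path_algebra G \<Longrightarrow> y \<in> path_algebra G \<Longrightarrow> pmult G x y \<in> path_algebra G"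
  unfolding pmult_def
  by (intro path_algebra_sum path_algebra_pscale path_mult_in) (auto simp: path_algebra_def)

lemma pmult_superset:
  assumes "finite A" "Poly_Mapping.keys x \<subseteq> A" "finite B" "Poly_Mapping.keys y \<subseteq> B"
  shows "pmult G x y = (\<Sum>p\<in>A. \<Sum>q\<in>B.
     pscale (Poly_Mapping.lookup x p * Poly_Mapping.lookup y q) (path_mult G p q))"
proof -
  have "pmult G x y = (\<Sum>p\<in>Poly_Mapping.keys x. \<Sum>q\<in>B.
     pscale (Poly_Mapping.lookup x p * Poly_Mapping.lookup y q) (path_mult G p q))"
    unfolding pmult_def using assms
    by (intro sum.cong sum.mono_neutral_left) (auto simp: in_keys_iff)
  also have "\<dots> = (\<Sum>p\<in>A. \<Sum>q\<in>B.
     pscale (Poly_Mapping.lookup x p * Poly_Mapping.lookup y q) (path_mult G p q))"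
    using assms by (intro sum.mono_neutral_left) (auto simp: in_keys_iff)
  finally show ?thesis .
qed

lemma pmult_diff_left: "pmult G (x - x') y = pmult G x y - pmult G x' y"
proof -
  let ?A = "Poly_Mapping.keys x \<union> Poly_Mapping.keys x'"
  have "Poly_Mapping.keys (x - x') \<subseteq> ?A" by (auto simp: in_keys_iff lookup_minus)
  then show ?thesis
    by (simp add: pmult_superset[of ?A _ "Poly_Mapping.keys y"] lookup_minus left_diff_distrib
        pa.scale_left_diff_distrib sum_subtractf)
qed

lemma pmult_diff_right: "pmult G x (y - y') = pmult G x y - pmult G x y'"
proof -
  let ?B = "Poly_Mapping.keys y \<union> Poly_Mapping.keys y'"
  have "Poly_Mapping.keys (y - y') \<subseteq> ?B" by (auto simp: in_keys_iff lookup_minus)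
  then show ?thesis
    by (simp add: pmult_superset[of "Poly_Mapping.keys x" _ ?B] lookup_minus right_diff_distrib
        pa.scale_left_diff_distrib sum_subtractf)
qed

lemma pmult_zero [simp]: "pmult G 0 y = 0" "pmult G x 0 = 0"
  by (simp_all add: pmult_def)

lemma derivations_commutator:
  assumes "D \<in> derivations G" "D' \<in> derivations G"
  shows "commutator D D' \<in> derivations G"
proof -
  have z: "E 0 = 0" if "E \<in> derivations G" for E :: "('a, 'b, 'c) path_op"
  proof -
    have "E (pscale 0 0) = pscale 0 (E 0)"
      using that path_algebra_zero[of G] unfolding derivations_def by blast
    then show ?thesis by simp
  qed
  show ?thesis
    using assms z[OF assms(1)] z[OF assms(2)]
    by (simp add: derivations_def commutator_def path_algebra_diff path_algebra_add
        path_algebra_pscale path_algebra_pmult pmult_diff_left pmult_diff_right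
        pa.scale_right_diff_distrib)
qed

end

theory Submission
  imports Defs
begin

text \<open>A derivation is determined by its values on vertices and arrows. Applying \<open>D\<close> to \<open>v v = v\<close>
  and to \<open>v w = 0\<close> shows that \<open>D v\<close> is supported on the nonclosed paths \<open>p\<close> starting or ending at
  \<open>v\<close>, and that the coefficients of \<open>p\<close> in \<open>D (h(p))\<close> and in \<open>D (t(p))\<close> are opposite. As \<open>D\<^sub>s\<close> maps
  \<open>h(s)\<close> to \<open>s\<close> and \<open>t(s)\<close> to \<open>-s\<close>, subtracting inner derivations makes \<open>D\<close> vanish on all vertices;
  then \<open>D r\<close> is supported on paths parallel to \<open>r\<close>, and \<open>D\<close> is the corresponding combination of the
  \<open>D\<^bsub>r,s\<^esub>\<close>. For independence, the coefficient of \<open>s\<close> in \<open>D (h(s))\<close> is 1 for \<open>D\<^sub>s\<close> and 0 for the other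
  basis elements; likewise for the coefficient of \<open>s\<close> in \<open>D r\<close> and \<open>D\<^bsub>r,s\<^esub>\<close>.\<close>

section \<open>Bilinearity and associativity\<close>

lemma pmult_add_left: "pmult G (x + x') y = pmult G x y + pmult G x' y"
  using pmult_diff_left[of G "x + x'" x' y] by (simp add: algebra_simps)

lemma pmult_add_right: "pmult G x (y + y') = pmult G x y + pmult G x y'"
  using pmult_diff_right[of G x "y + y'" y'] by (simp add: algebra_simps)

lemma pmult_pscale_left: "pmult G (pscale c x) y = pscale c (pmult G x y)"
proof -
  have "Poly_Mapping.keys (pscale c x) \<subseteq> Poly_Mapping.keys x" by (auto simp: in_keys_iff)
  then show ?thesis
    by (simp add: pmult_superset[of "Poly_Mapping.keys x" _ "Poly_Mapping.keys y"]
        pa.scale_sum_right mult.assoc)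
qed

lemma pmult_pscale_right: "pmult G x (pscale c y) = pscale c (pmult G x y)"
proof -
  have "Poly_Mapping.keys (pscale c y) \<subseteq> Poly_Mapping.keys y" by (auto simp: in_keys_iff)
  then show ?thesis
    by (simp add: pmult_superset[of "Poly_Mapping.keys x" _ "Poly_Mapping.keys y"]
        pa.scale_sum_right mult.left_commute)
qed

lemmas pmult_linear = pmult_add_left pmult_add_right pmult_pscale_left pmult_pscale_right

lemma pmult_pbasis: "pmult G (pbasis p) (pbasis q) = (path_mult G p q :: ('v, 'e, 'k::field) path_alg)"
  by (simp add: pmult_def pbasis_def)

lemma path_algebra_pbasis [simp]: "(pbasis p :: ('v, 'e, 'k::field) path_alg) \<in> path_algebra G \<longleftrightarrow> p \<in> paths G"
  by (simp add: path_algebra_def pbasis_def)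

lemma lookup_pbasis:
  "Poly_Mapping.lookup (pbasis p) q = (if p = q then 1 else 0)"
  by (simp add: pbasis_def lookup_single when_def)

lemma path_alg_expansion:
  "(\<Sum>p\<in>Poly_Mapping.keys x. pscale (Poly_Mapping.lookup x p) (pbasis p)) = x"
  by (rule poly_mapping_eqI)
    (simp add: lookup_sum pbasis_def lookup_single when_def in_keys_iff if_distrib cong: if_cong)

text \<open>Derivations are linear on the carrier only, so the \<open>scale\<close> and
  \<open>add\<close> cases hand over membership in it.\<close>

lemma path_algebra_induct [consumes 1, case_names zero pbasis scale add]:
  assumes "x \<in> path_algebra G"
    and zero: "P 0"
    and pbasis: "\<And>p. p \<in> paths G \<Longrightarrow> P (pbasis p)"
    and scale: "\<And>c x. x \<in> path_algebra G \<Longrightarrow> P x \<Longrightarrow> P (pscale c x)"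
    and add: "\<And>x y. x \<in> path_algebra G \<Longrightarrow> y \<in> path_algebra G \<Longrightarrow> P x \<Longrightarrow> P y \<Longrightarrow> P (x + y)"
  shows "P x"
proof -
  let ?f = "\<lambda>p. pscale (Poly_Mapping.lookup x p) (pbasis p)"
  \<comment> \<open>Membership is carried along since \<open>add\<close> asks for it at every
    partial sum.\<close>
  have "sum ?f A \<in> path_algebra G \<and> P (sum ?f A)" if "A \<subseteq> Poly_Mapping.keys x" for A
    using finite_subset[OF that finite_keys] that
  proof (induction A)
    case (insert p A)
    then have "p \<in> paths G" using assms(1) by (auto simp: path_algebra_def)
    then show ?case
      using insert by (auto intro!: add scale pbasis path_algebra_add path_algebra_pscale)
  qed (simp add: zero)
  from this[of "Poly_Mapping.keys x"] show ?thesis by (simp add: path_alg_expansion)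
qed

text \<open>\<open>pmult\<close> is bilinear on the whole type, so its identities can be proved
  without reference to the carrier.\<close>

lemma path_alg_induct [case_names zero pbasis scale add]:
  assumes zero: "P 0"
    and pbasis: "\<And>p. P (pbasis p)"
    and scale: "\<And>c x. P x \<Longrightarrow> P (pscale c x)"
    and add: "\<And>x y. P x \<Longrightarrow> P y \<Longrightarrow> P (x + y)"
  shows "P x"
proof -
  let ?f = "\<lambda>p. pscale (Poly_Mapping.lookup x p) (pbasis p)"
  have "P (sum ?f A)" if "finite A" for A
    using that by induction (auto intro: assms)
  from this[of "Poly_Mapping.keys x"] show ?thesis by (simp add: path_alg_expansion)
qed

section \<open>Concatenation of paths, and vertices as idempotents\<close>

lemma phead_simp: "phead G (u, es) = (if es = [] then u else head G (last es))"
  by (simp add: phead_def pre_digraph.awalk_verts_conv)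

lemma phead_Nil: "phead G (u, []) = u"
  by (simp add: phead_simp)

lemma phead_append:
  "phead G (u, es) = v \<Longrightarrow> phead G (u, es @ fs) = phead G (v, fs)"
  by (auto simp: phead_simp)

text \<open>Both sides are the full concatenation if both junctions match and 0 otherwise, because a
  concatenation of composable factors keeps the head of its second factor.\<close>

lemma pmult_pbasis_assoc:
  "pmult G (pmult G (pbasis p) (pbasis q)) (pbasis r) = pmult G (pbasis p) (pmult G (pbasis q) (pbasis r))"
proof -
  obtain u es where p: "p = (u, es)" by force
  obtain v fs where q: "q = (v, fs)" by force
  obtain w gs where r: "r = (w, gs)" by force
  show ?thesis
    unfolding p q r by (auto simp: pmult_pbasis path_mult_def ptail_def phead_append)
qed

lemma pmult_assoc: "pmult G (pmult G x y) z = pmult G x (pmult G y z)"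
proof (induction x rule: path_alg_induct)
  case (pbasis p)
  show ?case
  proof (induction y rule: path_alg_induct)
    case (pbasis q)
    show ?case
      by (induction z rule: path_alg_induct) (simp_all add: pmult_pbasis_assoc pmult_linear)
  qed (simp_all add: pmult_linear)
qed (simp_all add: pmult_linear)

text \<open>Right multiplication by the idempotent \<open>v\<close> is a projection. This and its
  mirror image below turn the Leibniz rule into conditions on coefficients.\<close>

lemma lookup_pmult_vertex_right:
  "Poly_Mapping.lookup (pmult G x (pbasis (v, []))) p
     = (if phead G p = v then Poly_Mapping.lookup x p else 0)"
  by (induction x rule: path_alg_induct)
    (auto simp: pmult_linear pmult_pbasis path_mult_def ptail_def lookup_pbasis lookup_add)

lemma lookup_pmult_vertex_left:
  "Poly_Mapping.lookup (pmult G (pbasis (v, [])) x) p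
     = (if ptail p = v then Poly_Mapping.lookup x p else 0)"
  by (induction x rule: path_alg_induct)
    (auto simp: pmult_linear pmult_pbasis path_mult_def ptail_def phead_simp lookup_pbasis lookup_add)

lemma pmult_pbasis_phead [simp]: "phead G p = v \<Longrightarrow> pmult G (pbasis p) (pbasis (v, [])) = pbasis p"
  by (auto simp: pmult_pbasis path_mult_def ptail_def)

lemma pmult_ptail_pbasis [simp]: "ptail p = v \<Longrightarrow> pmult G (pbasis (v, [])) (pbasis p) = pbasis p"
  by (auto simp: pmult_pbasis path_mult_def ptail_def phead_simp)

lemma pmult_pbasis_append:
  "phead G (u, es) = w \<Longrightarrow> pmult G (pbasis (u, es)) (pbasis (w, fs)) = pbasis (u, es @ fs)"
  by (simp add: pmult_pbasis path_mult_def ptail_def)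

lemma pmult_pbasis_eq_zero: "phead G p \<noteq> ptail q \<Longrightarrow> pmult G (pbasis p) (pbasis q) = 0"
  by (simp add: pmult_pbasis path_mult_def)

lemma ptail_arrow_path [simp]: "ptail (arrow_path G e) = tail G e"
  by (simp add: arrow_path_def ptail_def)

lemma phead_arrow_path [simp]: "phead G (arrow_path G e) = head G e"
  by (simp add: arrow_path_def phead_simp)

section \<open>Paths of a quiver\<close>

lemma phead_eq_of_cas: "pre_digraph.cas G u es v \<Longrightarrow> phead G (u, es) = v"
  by (induction es arbitrary: u) (auto simp: phead_simp pre_digraph.cas.simps split: if_splits)

lemma phead_Cons: "phead G (u, e # es) = phead G (head G e, es)"
  by (simp add: phead_simp)

text \<open>Splitting off the first arrow, the step of the inductions on arrow lists.\<close>

lemma pbasis_Cons: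
  "tail G e = u \<Longrightarrow> pbasis (u, e # es) = pmult G (pbasis (arrow_path G e)) (pbasis (head G e, es))"
  by (simp add: pmult_pbasis path_mult_def arrow_path_def ptail_def phead_simp)

lemma (in wf_digraph) vertex_in_paths [simp]: "(v, []) \<in> paths G \<longleftrightarrow> v \<in> verts G"
  by (auto simp: paths_def awalk_def)

lemma (in wf_digraph) paths_Cons:
  "(u, e # es) \<in> paths G \<longleftrightarrow> e \<in> arcs G \<and> tail G e = u \<and> (head G e, es) \<in> paths G"
  by (auto simp: paths_def awalk_def)

lemma (in wf_digraph) arrow_path_in_paths [simp]: "e \<in> arcs G \<Longrightarrow> arrow_path G e \<in> paths G"
  by (simp add: arrow_path_def paths_Cons)

lemma (in wf_digraph) ptail_in_verts: "p \<in> paths G \<Longrightarrow> ptail p \<in> verts G"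
  by (auto simp: paths_def awalk_def ptail_def)

lemma (in wf_digraph) phead_in_verts:
  assumes "p \<in> paths G"
  shows "phead G p \<in> verts G"
proof -
  obtain u es v where p: "p = (u, es)" and w: "awalk u es v"
    using assms by (auto simp: paths_def)
  have "v \<in> verts G" using w by (rule awalk_last_in_verts)
  moreover have "cas u es v" using w by (simp add: awalk_def)
  ultimately show ?thesis using phead_eq_of_cas[of G u es v] by (simp add: p)
qed

section \<open>Derivations\<close>

lemma sum_fun_apply: "sum f A x = (\<Sum>i\<in>A. f i x)"
  by (induction A rule: infinite_finite_induct) auto

lemma derivationD:
  assumes "D \<in> derivations G"
  shows derivation_closed: "x \<in> path_algebra G \<Longrightarrow> D x \<in> path_algebra G"
    and derivation_outside: "x \<notin> path_algebra G \<Longrightarrow> D x = 0"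
    and derivation_add: "x \<in> path_algebra G \<Longrightarrow> y \<in> path_algebra G \<Longrightarrow> D (x + y) = D x + D y"
    and derivation_pscale: "x \<in> path_algebra G \<Longrightarrow> D (pscale c x) = pscale c (D x)"
    and derivation_pmult: "x \<in> path_algebra G \<Longrightarrow> y \<in> path_algebra G \<Longrightarrow>
      D (pmult G x y) = pmult G (D x) y + pmult G x (D y)"
  using assms by (auto simp: derivations_def)

lemma derivation_zero: "D \<in> derivations G \<Longrightarrow> D 0 = 0"
  using derivation_pscale[of D G 0 0] by simp

lemma subspace_derivations: "op.subspace (derivations G)"
proof (rule op.subspaceI)
  show "0 \<in> derivations G" by (simp add: derivations_def)
  show "D + E \<in> derivations G" if "D \<in> derivations G" "E \<in> derivations G" for D E
    using that
    by (auto simp: derivations_def path_algebra_add pmult_linear pa.scale_right_distrib)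
  show "op_scale c D \<in> derivations G" if "D \<in> derivations G" for c D
    using that
    by (auto simp: derivations_def op_scale_def path_algebra_pscale pmult_linear
        pa.scale_right_distrib mult.commute)
qed

text \<open>By the Leibniz rule the value on a path reduces to values on its arrows and its final
  vertex. Linearity covers the carrier, and outside it the operator is 0 by convention.\<close>

lemma (in wf_digraph) derivation_eq_zeroI:
  assumes D: "D \<in> derivations G"
    and vertex: "\<And>v. v \<in> verts G \<Longrightarrow> D (pbasis (v, [])) = 0"
    and arrow: "\<And>e. e \<in> arcs G \<Longrightarrow> D (pbasis (arrow_path G e)) = 0"
  shows "D = 0"
proof
  have path: "D (pbasis (u, es)) = 0" if "(u, es) \<in> paths G" for u es
    using that
  proof (induction es arbitrary: u)
    case (Cons e es)
    then show ?case
      by (auto simp: paths_Cons pbasis_Cons derivation_pmult[OF D] arrow)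
  qed (simp add: vertex)
  show "D x = 0 x" for x
  proof (cases "x \<in> path_algebra G")
    case True
    then have "D x = 0"
    proof (induction x rule: path_algebra_induct)
      case (pbasis p)
      then show ?case using path[of "fst p" "snd p"] by simp
    qed (simp_all add: derivation_zero[OF D] derivation_add[OF D] derivation_pscale[OF D])
    then show ?thesis by simp
  qed (simp add: derivation_outside[OF D])
qed

text \<open>In (sx - xs)y + x(sy - ys) the terms xsy cancel by associativity, leaving sxy -
  xys.\<close>

lemma inner_der_in_derivations:
  assumes "s \<in> paths G"
  shows "inner_der G s \<in> derivations G"
  using assms
  by (simp add: derivations_def inner_der_def path_algebra_add path_algebra_pscale
      path_algebra_pmult path_algebra_diff pmult_linear pmult_diff_left pmult_diff_right
      pmult_assoc pa.scale_right_diff_distrib)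

section \<open>The operators D_{r,s} as derivations\<close>

lemma parallel_arrow_path:
  "parallel_paths G s (arrow_path G r) \<longleftrightarrow> ptail s = tail G r \<and> phead G s = head G r"
  by (simp add: parallel_paths_def)

lemma arrow_der_add:
  assumes "x \<in> path_algebra G" "y \<in> path_algebra G"
  shows "arrow_der G r s (x + y) = arrow_der G r s x + arrow_der G r s y"
proof -
  let ?K = "Poly_Mapping.keys x \<union> Poly_Mapping.keys y"
  \<comment> \<open>A common index set lets the three sums be compared term by term.\<close>
  have *: "arrow_der G r s z = (\<Sum>p\<in>?K.
      pscale (Poly_Mapping.lookup z p) (arrow_der_path G r s (fst p) (snd p)))"
    if "z \<in> path_algebra G" "Poly_Mapping.keys z \<subseteq> ?K" for z
    using that unfolding arrow_der_def
    by (auto intro!: sum.mono_neutral_left simp: in_keys_iff)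
  show ?thesis
    using assms keys_add[of x y]
    by (simp add: * path_algebra_add lookup_add pa.scale_left_distrib sum.distrib)
qed

lemma arrow_der_pscale:
  assumes "x \<in> path_algebra G"
  shows "arrow_der G r s (pscale c x) = pscale c (arrow_der G r s x)"
proof -
  have "(\<Sum>p\<in>Poly_Mapping.keys (pscale c x).
      pscale (Poly_Mapping.lookup (pscale c x) p) (arrow_der_path G r s (fst p) (snd p)))
    = (\<Sum>p\<in>Poly_Mapping.keys x.
      pscale (Poly_Mapping.lookup (pscale c x) p) (arrow_der_path G r s (fst p) (snd p)))"
    by (rule sum.mono_neutral_left) (auto simp: in_keys_iff)
  then show ?thesis
    using assms by (simp add: arrow_der_def path_algebra_pscale pa.scale_sum_right)
qed

lemma arrow_der_zero: "arrow_der G r s 0 = 0"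
  by (simp add: arrow_der_def)

lemma arrow_der_pbasis:
  assumes "p \<in> paths G"
  shows "arrow_der G r s (pbasis p) = arrow_der_path G r s (fst p) (snd p)"
  using assms by (simp add: arrow_der_def) (simp add: pbasis_def)

context wf_digraph
begin

context
  fixes r s
  assumes r: "r \<in> arcs G" and s: "s \<in> paths G" and parallel: "parallel_paths G s (arrow_path G r)"
begin

lemma arrow_der_path_in_path_algebra:
  "(u, es) \<in> paths G \<Longrightarrow> arrow_der_path G r s u es \<in> path_algebra G"
  by (induction es arbitrary: u)
    (auto simp: paths_Cons s intro!: path_algebra_add path_algebra_pmult)

text \<open>Each term begins with the first arrow of the path or, where that arrow is
  \<open>r\<close>, with \<open>s\<close>, which has the same tail.\<close>

lemma pmult_ptail_arrow_der_path:
  assumes "(u, es) \<in> paths G"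
  shows "pmult G (pbasis (u, [])) (arrow_der_path G r s u es) = arrow_der_path G r s u es"
proof (cases es)
  case (Cons e fs)
  have "ptail s = tail G r" using parallel by (simp add: parallel_arrow_path)
  then show ?thesis
    using assms Cons by (auto simp: paths_Cons pmult_add_right simp flip: pmult_assoc)
qed simp

text \<open>The right factor of each term in the recursion is the remaining path or its image, and
  both end at the original head.\<close>

lemma pmult_arrow_der_path_phead:
  "(u, es) \<in> paths G \<Longrightarrow>
    pmult G (arrow_der_path G r s u es) (pbasis (phead G (u, es), [])) = arrow_der_path G r s u es"
proof (induction es arbitrary: u)
  case (Cons e es)
  then show ?case
    by (auto simp: paths_Cons phead_Cons pmult_add_left pmult_assoc)
qed simp

text \<open>The Leibniz rule for composable paths, by induction on the first factor.\<close>

lemma arrow_der_path_append: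
  "(u, es) \<in> paths G \<Longrightarrow> (w, fs) \<in> paths G \<Longrightarrow> phead G (u, es) = w \<Longrightarrow>
    arrow_der_path G r s u (es @ fs)
      = pmult G (arrow_der_path G r s u es) (pbasis (w, fs))
        + pmult G (pbasis (u, es)) (arrow_der_path G r s w fs)"
proof (induction es arbitrary: u)
  case Nil
  \<comment> \<open>The first factor is the vertex \<open>w\<close>, which acts as the identity on
    the image of a path with tail \<open>w\<close>.\<close>
  then show ?case by (simp add: phead_simp pmult_ptail_arrow_der_path)
next
  case (Cons e es)
  then have e: "tail G e = u" "(head G e, es) \<in> paths G" "phead G (head G e, es) = w"
    by (auto simp: paths_Cons phead_Cons)
  show ?case
    using Cons.IH[OF e(2) Cons.prems(2) e(3)] e(3)
    by (auto simp: pbasis_Cons[OF e(1)] pmult_linear pmult_assoc pmult_pbasis_append add.assoc)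
qed

lemma arrow_der_pmult_pbasis:
  assumes p: "p \<in> paths G" and q: "q \<in> paths G"
  shows "(arrow_der G r s (pmult G (pbasis p) (pbasis q)) :: ('a, 'b, 'k::field) path_alg)
    = pmult G (arrow_der G r s (pbasis p)) (pbasis q)
      + pmult G (pbasis p) (arrow_der G r s (pbasis q))"
proof (cases "phead G p = ptail q")
  case True
  obtain u es where [simp]: "p = (u, es)" by force
  obtain w fs where [simp]: "q = (w, fs)" by force
  have w: "phead G (u, es) = w" using True by (simp add: ptail_def)
  \<comment> \<open>Closure of the carrier under products, read on basis elements.\<close>
  then have "(u, es @ fs) \<in> paths G"
    using path_algebra_pmult[of "pbasis p :: ('a, 'b, 'k) path_alg" G "pbasis q"] p q
    by (simp add: pmult_pbasis_append)
  then show ?thesis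
    using arrow_der_path_append[of u es w fs] p q
    by (simp add: arrow_der_pbasis pmult_pbasis_append w)
next
  case False
  \<comment> \<open>The vertex h(p) can be inserted after the image of \<open>p\<close>, and h(p) q
    = 0. The next product vanishes likewise, with t(q) inserted.\<close>
  have "pmult G (arrow_der_path G r s (fst p) (snd p)) (pbasis q) = (0 :: ('a, 'b, 'k) path_alg)"
    using pmult_arrow_der_path_phead[of "fst p" "snd p"] p False
      pmult_assoc[of G _ "pbasis (phead G p, [])" "pbasis q"]
    by (metis pmult_pbasis_eq_zero pmult_zero(2) phead_Nil prod.collapse)
  moreover have "pmult G (pbasis p) (arrow_der_path G r s (fst q) (snd q)) = (0 :: ('a, 'b, 'k) path_alg)"
    using pmult_ptail_arrow_der_path[of "fst q" "snd q"] q False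
      pmult_assoc[of G "pbasis p" "pbasis (ptail q, [])"]
    by (metis pmult_pbasis_eq_zero pmult_zero(1) ptail_def fst_conv prod.collapse)
  ultimately show ?thesis using p q by (simp add: pmult_pbasis_eq_zero[OF False] arrow_der_pbasis arrow_der_zero)
qed

lemma arrow_der_pmult:
  assumes x: "x \<in> path_algebra G" and y: "y \<in> path_algebra G"
  shows "arrow_der G r s (pmult G x y) = pmult G (arrow_der G r s x) y + pmult G x (arrow_der G r s y)"
  using x
proof (induction x rule: path_algebra_induct)
  case (pbasis p)
  show ?case
    using y
    by (induction y rule: path_algebra_induct)
      (use pbasis in \<open>simp_all add: arrow_der_pmult_pbasis arrow_der_zero arrow_der_add
        arrow_der_pscale path_algebra_pmult pmult_linear pa.scale_right_distrib\<close>)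
qed (use y in \<open>simp_all add: arrow_der_zero arrow_der_add
        arrow_der_pscale path_algebra_pmult pmult_linear pa.scale_right_distrib\<close>)

lemma arrow_der_in_derivations: "arrow_der G r s \<in> derivations G"
proof -
  have "arrow_der G r s x \<in> path_algebra G" if "x \<in> path_algebra G" for x
    using that
    by (induction x rule: path_algebra_induct)
      (auto simp: arrow_der_zero arrow_der_add arrow_der_pscale arrow_der_pbasis
        arrow_der_path_in_path_algebra path_algebra_add path_algebra_pscale)
  moreover have "arrow_der G r s x = 0" if "x \<notin> path_algebra G" for x
    using that by (simp add: arrow_der_def)
  ultimately show ?thesis
    by (auto simp: derivations_def arrow_der_add arrow_der_pscale arrow_der_pmult)
qed

lemma arrow_der_vertex: "arrow_der G r s (pbasis (v, [])) = 0"
  by (simp add: arrow_der_def) (simp add: pbasis_def)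

lemma arrow_der_arrow:
  assumes "e \<in> arcs G"
  shows "arrow_der G r s (pbasis (arrow_path G e)) = (if e = r then pbasis s else 0)"
proof -
  \<comment> \<open>For \<open>e = r\<close> the recursion gives the product of \<open>s\<close>
    with the vertex h(r); equality of heads makes this \<open>s\<close>.\<close>
  have "phead G s = head G r" using parallel by (simp add: parallel_arrow_path)
  then show ?thesis
    unfolding arrow_der_pbasis[OF arrow_path_in_paths[OF assms]] by (simp add: arrow_path_def)
qed

end

end

section \<open>Linear independence\<close>

text \<open>The coordinates of a common element with respect to \<open>A \<union> B\<close> are
  supported both in \<open>A\<close> and in \<open>B\<close>, hence vanish.\<close>

lemma (in vector_space) span_Int_eq_zero:
  assumes indep: "independent (A \<union> B)" and disj: "A \<inter> B = {}"
  shows "span A \<inter> span B = {0}"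
proof -
  have "x = 0" if "x \<in> span A" "x \<in> span B" for x
  proof -
    let ?rep = "representation (A \<union> B) x"
    have "?rep = representation A x" "?rep = representation B x"
      using that indep by (auto intro: representation_extend)
    then have "?rep b = 0" for b
      using representation_ne_zero[of A x b] representation_ne_zero[of B x b] disj by fastforce
    moreover have "x \<in> span (A \<union> B)"
      using that(1) span_mono[of A "A \<union> B"] by auto
    ultimately show ?thesis
      using sum_nonzero_representation_eq[OF indep, of x] by simp
  qed
  then show ?thesis by (auto simp: span_zero)
qed

lemma subspace_lookup_eq_zero: "op.subspace {D. Poly_Mapping.lookup (D x) p = 0}"
  by (rule op.subspaceI) (auto simp: lookup_add op_scale_def)

text \<open>This is sv - vs. For closed \<open>s\<close> the two terms cancel, so vertices detect
  only nonclosed paths.\<close>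

lemma (in wf_digraph) lookup_inner_der_vertex:
  assumes "v \<in> verts G"
  shows "Poly_Mapping.lookup (inner_der G s (pbasis (v, []))) p
    = (if p = s then (if phead G s = v then 1 else 0) - (if ptail s = v then 1 else 0) else 0)"
  using assms
  by (auto simp: inner_der_def lookup_minus lookup_pmult_vertex_left lookup_pmult_vertex_right
      lookup_pbasis)

text \<open>If the product se is nonzero and parallel to e, then t(s) = t(e) = h(s), so
  \<open>s\<close> would be closed. For es the same holds with h(s) = h(e) = t(s).\<close>

lemma (in wf_digraph) lookup_inner_der_arrow:
  assumes s: "phead G s \<noteq> ptail s" and "e \<in> arcs G" and q: "parallel_paths G q (arrow_path G e)"
  shows "Poly_Mapping.lookup (inner_der G s (pbasis (arrow_path G e))) q = 0"
proof -
  obtain u es where s_eq: "s = (u, es)" by force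
  have "phead G (tail G e, e # es) = phead G s" if "head G e = ptail s"
    using that by (simp add: s_eq phead_Cons ptail_def)
  then show ?thesis
    using assms
    by (auto simp: parallel_arrow_path inner_der_def lookup_minus pmult_pbasis path_mult_def lookup_pbasis)
      (auto simp: s_eq arrow_path_def ptail_def)
qed

lemma (in wf_digraph) independent_der_basis:
  "op.independent (der_basis1 G \<union> der_basis2 G :: ('a, 'b, 'k::field) path_op set)"
  unfolding op.dependent_def
proof clarify
  let ?B = "der_basis1 G \<union> der_basis2 G :: ('a, 'b, 'k) path_op set"
  fix b
  assume b: "b \<in> ?B" and span: "b \<in> op.span (?B - {b})"
  \<comment> \<open>The coefficient of \<open>p\<close> in \<open>D x\<close> is linear in
    \<open>D\<close>; if it is 0 on the other basis elements, it is 0 on their span, which contains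
    \<open>b\<close>.\<close>
  have absurd: False
    if "Poly_Mapping.lookup (b x) p \<noteq> 0"
      and "\<And>D. D \<in> ?B \<Longrightarrow> D \<noteq> b \<Longrightarrow> Poly_Mapping.lookup (D x) p = 0" for x p
    using that span op.span_minimal[OF _ subspace_lookup_eq_zero[of x p], of "?B - {b}"] by auto
  from b show False
  proof
    assume "b \<in> der_basis1 G"
    then obtain s where s: "s \<in> nonclosed_paths G" and [simp]: "b = inner_der G s"
      by (auto simp: der_basis1_def)
    have "s \<in> paths G" "phead G s \<noteq> ptail s"
      using s by (auto simp: nonclosed_paths_def)
    then show False
      by (intro absurd[of "pbasis (phead G s, [])" s])
        (auto simp: der_basis1_def der_basis2_def lookup_inner_der_vertex phead_in_verts
          arrow_der_vertex)
  next
    assume "b \<in> der_basis2 G"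
    then obtain r s where r: "r \<in> arcs G" and s: "s \<in> paths G"
        and rs: "parallel_paths G s (arrow_path G r)" and [simp]: "b = arrow_der G r s"
      by (auto simp: der_basis2_def)
    \<comment> \<open>If \<open>D\<close> is D_{r',s'}, it differs from \<open>b\<close> in an
      index: for r' different from \<open>r\<close> it kills \<open>r\<close>, otherwise it sends
      \<open>r\<close> to a path other than \<open>s\<close>.\<close>
    have "Poly_Mapping.lookup (D (pbasis (arrow_path G r))) s = 0" if "D \<in> ?B" "D \<noteq> b" for D
      using that r rs
      by (auto simp: der_basis1_def der_basis2_def nonclosed_paths_def lookup_inner_der_arrow
          arrow_der_arrow lookup_pbasis)
    moreover have "Poly_Mapping.lookup (b (pbasis (arrow_path G r))) s \<noteq> 0"
      using r s rs by (simp add: arrow_der_arrow lookup_pbasis)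
    ultimately show False by (rule absurd[rotated])
  qed
qed

text \<open>D_s does not vanish at the vertex h(s), while every D_{r,q} kills all vertices.\<close>

lemma (in wf_digraph) der_basis_disjoint:
  "der_basis1 G \<inter> der_basis2 G = ({} :: ('a, 'b, 'k::field) path_op set)"
proof -
  have False
    if eq: "inner_der G s = (arrow_der G r q :: ('a, 'b, 'k) path_op)" and s: "s \<in> nonclosed_paths G"
      and "r \<in> arcs G" "q \<in> paths G" "parallel_paths G q (arrow_path G r)" for s r q
  proof -
    have "Poly_Mapping.lookup (inner_der G s (pbasis (phead G s, [])) :: ('a, 'b, 'k) path_alg) s = 1"
      using s by (auto simp: lookup_inner_der_vertex nonclosed_paths_def phead_in_verts)
    then show False using that by (simp add: eq arrow_der_vertex)
  qed
  then show ?thesis by (fastforce simp: der_basis1_def der_basis2_def)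
qed

section \<open>Spanning\<close>

text \<open>The Leibniz rule for vv = v. It forces the coefficient to vanish unless exactly one end
  of \<open>p\<close> is \<open>v\<close>.\<close>

lemma (in wf_digraph) lookup_derivation_vertex:
  assumes D: "D \<in> derivations G" and v: "v \<in> verts G"
  shows "Poly_Mapping.lookup (D (pbasis (v, []))) p
    = (if phead G p = v then Poly_Mapping.lookup (D (pbasis (v, []))) p else 0)
      + (if ptail p = v then Poly_Mapping.lookup (D (pbasis (v, []))) p else 0)"
proof -
  have "D (pbasis (v, [])) = D (pmult G (pbasis (v, [])) (pbasis (v, [])))"
    by (simp add: phead_Nil)
  also have "\<dots> = pmult G (D (pbasis (v, []))) (pbasis (v, [])) + pmult G (pbasis (v, [])) (D (pbasis (v, [])))"
    using v by (simp add: derivation_pmult[OF D] del: pmult_pbasis_phead pmult_ptail_pbasis)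
  finally show ?thesis
    \<comment> \<open>D(v) occurs on both sides, so the equation is applied once here instead of
      serving as a rewrite rule.\<close>
    by (rule arg_cong[of _ _ "\<lambda>x. Poly_Mapping.lookup x p", THEN trans])
      (simp only: lookup_add lookup_pmult_vertex_left lookup_pmult_vertex_right)
qed

text \<open>The Leibniz rule for vw = 0, read at a path from \<open>v\<close> to \<open>w\<close>,
  which both projections preserve.\<close>

lemma (in wf_digraph) lookup_derivation_two_vertices:
  assumes D: "D \<in> derivations G" and v: "v \<in> verts G" and w: "w \<in> verts G" and "v \<noteq> w"
    and p: "ptail p = v" "phead G p = w"
  shows "Poly_Mapping.lookup (D (pbasis (v, []))) p + Poly_Mapping.lookup (D (pbasis (w, []))) p = 0"
proof -
  have "pmult G (D (pbasis (v, []))) (pbasis (w, [])) + pmult G (pbasis (v, [])) (D (pbasis (w, [])))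
      = D (pmult G (pbasis (v, [])) (pbasis (w, [])))"
    using v w by (simp add: derivation_pmult[OF D])
  also have "\<dots> = 0"
    using \<open>v \<noteq> w\<close> by (simp add: pmult_pbasis_eq_zero phead_Nil ptail_def derivation_zero[OF D])
  finally have "Poly_Mapping.lookup (pmult G (D (pbasis (v, []))) (pbasis (w, []))
      + pmult G (pbasis (v, [])) (D (pbasis (w, [])))) p = 0"
    by simp
  then show ?thesis
    using p by (simp add: lookup_add lookup_pmult_vertex_left lookup_pmult_vertex_right)
qed

lemma (in fin_digraph) derivation_minus_inner_kills_vertices:
  fixes D :: "('a, 'b, 'k::field) path_op"
  assumes D: "D \<in> derivations G"
  obtains E where "E \<in> op.span (der_basis1 G)"
    and "\<And>v. v \<in> verts G \<Longrightarrow> (D - E) (pbasis (v, [])) = 0"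
proof -
  define c where "c v p = Poly_Mapping.lookup (D (pbasis (v, []))) p" for v p
  define S where "S = {s \<in> nonclosed_paths G. \<exists>v\<in>verts G. c v s \<noteq> 0}"
  \<comment> \<open>D_s(h(s)) has coefficient 1 at \<open>s\<close>, so the weight of D_s must be
    the coefficient of \<open>s\<close> in D(h(s)).\<close>
  define E where "E = (\<Sum>s\<in>S. op_scale (c (phead G s) s) (inner_der G s))"
  \<comment> \<open>There are finitely many vertices, each with an image of finite support.\<close>
  have "finite S"
    by (rule finite_subset[of _ "\<Union>v\<in>verts G. Poly_Mapping.keys (D (pbasis (v, [])))"])
      (auto simp: S_def c_def in_keys_iff)
  have "E \<in> op.span (der_basis1 G)"
    unfolding E_def
    by (intro op.span_sum op.span_scale op.span_base) (auto simp: S_def der_basis1_def)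
  moreover have "(D - E) (pbasis (v, [])) = 0" if v: "v \<in> verts G" for v
  proof (rule poly_mapping_eqI)
    fix p
    have path: "p \<in> paths G" if "c v p \<noteq> 0"
      using that derivation_closed[OF D, of "pbasis (v, [])"] v
      by (auto simp: c_def path_algebra_def in_keys_iff pbasis_def)
    have "Poly_Mapping.lookup (E (pbasis (v, []))) p
        = (\<Sum>s\<in>S. if p = s then c (phead G s) s * ((if phead G s = v then 1 else 0) - (if ptail s = v then 1 else 0)) else 0)"
      using v unfolding E_def
      by (auto simp: sum_fun_apply lookup_sum op_scale_def lookup_inner_der_vertex intro!: sum.cong)
    also have "\<dots> = (if p \<in> S then c (phead G p) p * ((if phead G p = v then 1 else 0) - (if ptail p = v then 1 else 0)) else 0)"
      using \<open>finite S\<close> by simp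
    also have "\<dots> = c v p"
    proof (cases "p \<in> paths G")
      case True
      then have h: "phead G p \<in> verts G" "ptail p \<in> verts G"
        by (simp_all add: phead_in_verts ptail_in_verts)
      have one: "c v p = (if phead G p = v then c v p else 0) + (if ptail p = v then c v p else 0)"
        unfolding c_def by (rule lookup_derivation_vertex[OF D v])
      \<comment> \<open>Here c = c + c, and cancellation gives c = 0 in every
        characteristic.\<close>
      have closed: "c v p = 0" if "phead G p = v" "ptail p = v"
        using one that by (simp only: simp_thms if_True add_cancel_right_right)
      have two: "c (ptail p) p + c (phead G p) p = 0" if "phead G p \<noteq> ptail p"
        unfolding c_def using lookup_derivation_two_vertices[OF D h(2,1)] that by simp
      have "p \<in> S" if "c v p \<noteq> 0" "phead G p \<noteq> ptail p"
        using that True v by (auto simp: S_def nonclosed_paths_def)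
      \<comment> \<open>At h(p) the weight is right by choice, at t(p) by \<open>two\<close>; for
        closed \<open>p\<close> or \<open>v\<close> not an end of \<open>p\<close> both sides are
        0.\<close>
      then show ?thesis
        using one closed two
        by (cases "phead G p = ptail p"; cases "phead G p = v"; cases "ptail p = v")
          (auto simp: S_def nonclosed_paths_def add_eq_0_iff)
    qed (use path in \<open>auto simp: S_def nonclosed_paths_def\<close>)
    finally show "Poly_Mapping.lookup ((D - E) (pbasis (v, []))) p = Poly_Mapping.lookup 0 p"
      by (simp add: lookup_minus c_def)
  qed
  ultimately show thesis by (rule that)
qed

text \<open>Since \<open>D\<close> kills vertices, the Leibniz rule for e = e h(e) and e = t(e) e
  shows that D(e) is fixed by both projections.\<close>

lemma (in wf_digraph) parallel_of_lookup_derivation_arrow: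
  assumes D: "D \<in> derivations G" and vertex: "\<And>v. v \<in> verts G \<Longrightarrow> D (pbasis (v, [])) = 0"
    and e: "e \<in> arcs G" and q: "Poly_Mapping.lookup (D (pbasis (arrow_path G e))) q \<noteq> 0"
  shows "parallel_paths G q (arrow_path G e)"
proof -
  have "D (pmult G (pbasis (arrow_path G e)) (pbasis (head G e, [])))
      = pmult G (D (pbasis (arrow_path G e))) (pbasis (head G e, []))"
    using e vertex
    by (simp add: derivation_pmult[OF D] del: pmult_pbasis_phead)
  then have "phead G q = head G e"
    using q lookup_pmult_vertex_right[of G "D (pbasis (arrow_path G e))" "head G e" q]
    by (auto split: if_splits)
  moreover have "D (pmult G (pbasis (tail G e, [])) (pbasis (arrow_path G e)))
      = pmult G (pbasis (tail G e, [])) (D (pbasis (arrow_path G e)))"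
    using e vertex
    by (simp add: derivation_pmult[OF D] del: pmult_ptail_pbasis)
  then have "ptail q = tail G e"
    using q lookup_pmult_vertex_left[of G "tail G e" "D (pbasis (arrow_path G e))" q]
    by (auto split: if_splits)
  ultimately show ?thesis by (simp add: parallel_arrow_path)
qed

lemma (in fin_digraph) derivation_in_span_der_basis2:
  fixes D :: "('a, 'b, 'k::field) path_op"
  assumes D: "D \<in> derivations G" and vertex: "\<And>v. v \<in> verts G \<Longrightarrow> D (pbasis (v, [])) = 0"
  shows "D \<in> op.span (der_basis2 G)"
proof -
  define K where "K e = Poly_Mapping.keys (D (pbasis (arrow_path G e)))" for e
  define F where "F r s = op_scale (Poly_Mapping.lookup (D (pbasis (arrow_path G r))) s) (arrow_der G r s)" for r s
  define E where "E = (\<Sum>r\<in>arcs G. \<Sum>s\<in>K r. F r s)"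
  have K: "s \<in> paths G" "parallel_paths G s (arrow_path G r)" if "r \<in> arcs G" "s \<in> K r" for r s
    using that derivation_closed[OF D, of "pbasis (arrow_path G r)"]
      parallel_of_lookup_derivation_arrow[OF D vertex, of r s]
    by (auto simp: K_def path_algebra_def[of G] in_keys_iff pbasis_def)
  have basis: "arrow_der G r s \<in> der_basis2 G" if "r \<in> arcs G" "s \<in> K r" for r s
    unfolding der_basis2_def using that K[OF that] by blast
  have der: "F r s \<in> derivations G" if "r \<in> arcs G" "s \<in> K r" for r s
    unfolding F_def
    by (intro op.subspace_scale[OF subspace_derivations] arrow_der_in_derivations that K[OF that])
  have "D - E = 0"
  proof (rule derivation_eq_zeroI)
    show "D - E \<in> derivations G"
      unfolding E_def using D der
      by (intro op.subspace_diff op.subspace_sum subspace_derivations) auto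
    show "(D - E) (pbasis (v, [])) = 0" if "v \<in> verts G" for v
      by (simp add: E_def F_def sum_fun_apply op_scale_def vertex[OF that] arrow_der_vertex K)
    show "(D - E) (pbasis (arrow_path G e)) = 0" if e: "e \<in> arcs G" for e
    proof -
      \<comment> \<open>D_{r,s} kills \<open>e\<close> for \<open>r\<close> other than
        \<open>e\<close>, and D_{e,s}(e) = s, so what remains is the expansion of D(e) in
        paths.\<close>
      have "E (pbasis (arrow_path G e)) = (\<Sum>r\<in>arcs G. if r = e then
          \<Sum>s\<in>K e. pscale (Poly_Mapping.lookup (D (pbasis (arrow_path G e))) s) (pbasis s) else 0)"
        unfolding E_def sum_fun_apply
        by (intro sum.cong refl)
          (auto simp: F_def op_scale_def arrow_der_arrow K e)
      also have "\<dots> = D (pbasis (arrow_path G e))"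
        using e by (simp add: K_def path_alg_expansion)
      finally show ?thesis by simp
    qed
  qed
  moreover have "E \<in> op.span (der_basis2 G)"
    unfolding E_def F_def using basis
    by (intro op.span_sum op.span_scale op.span_base) auto
  ultimately show ?thesis by simp
qed

lemma (in wf_digraph) der_basis_subset_derivations:
  "der_basis1 G \<union> der_basis2 G \<subseteq> derivations G"
  by (auto simp: der_basis1_def der_basis2_def nonclosed_paths_def
      intro: inner_der_in_derivations arrow_der_in_derivations)

lemma (in fin_digraph) span_der_basis:
  "op.span (der_basis1 G \<union> der_basis2 G) = (derivations G :: ('a, 'b, 'k::field) path_op set)"
proof
  show "op.span (der_basis1 G \<union> der_basis2 G) \<subseteq> (derivations G :: ('a, 'b, 'k) path_op set)"
    by (rule op.span_minimal[OF der_basis_subset_derivations subspace_derivations])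
  show "(derivations G :: ('a, 'b, 'k) path_op set) \<subseteq> op.span (der_basis1 G \<union> der_basis2 G)"
  proof
    fix D :: "('a, 'b, 'k) path_op"
    assume D: "D \<in> derivations G"
    obtain E where E: "E \<in> op.span (der_basis1 G)"
        "\<And>v. v \<in> verts G \<Longrightarrow> (D - E) (pbasis (v, [])) = 0"
      using derivation_minus_inner_kills_vertices[OF D] by blast
    \<comment> \<open>Thus \<open>E\<close> is a derivation, and so is \<open>D - E\<close>.\<close>
    have "op.span (der_basis1 G) \<subseteq> (derivations G :: ('a, 'b, 'k) path_op set)"
      using der_basis_subset_derivations by (intro op.span_minimal subspace_derivations) auto
    then have "D - E \<in> derivations G"
      using D E(1) by (intro op.subspace_diff[OF subspace_derivations]) auto
    then have "D - E \<in> op.span (der_basis2 G)"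
      using E(2) by (rule derivation_in_span_der_basis2)
    then have "E + (D - E) \<in> op.span (der_basis1 G \<union> der_basis2 G)"
      using E(1) unfolding op.span_Un by blast
    then show "D \<in> op.span (der_basis1 G \<union> der_basis2 G)" by simp
  qed
qed

theorem theorem3p4:
  fixes G :: "('v, 'e) pre_digraph"
  assumes "fin_digraph G"
  shows "is_basis_of (der_basis1 G \<union> der_basis2 G)
           (derivations G :: ('v, 'e, 'k::field) path_op set)
    \<and> is_basis_of (der_basis1 G :: ('v, 'e, 'k) path_op set) (op.span (der_basis1 G))
    \<and> is_basis_of (der_basis2 G :: ('v, 'e, 'k) path_op set) (op.span (der_basis2 G))
    \<and> is_direct_sum (derivations G :: ('v, 'e, 'k) path_op set)
         (op.span (der_basis1 G)) (op.span (der_basis2 G))"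
proof -
  interpret fin_digraph G by (rule assms)
  let ?B1 = "der_basis1 G :: ('v, 'e, 'k) path_op set"
  let ?B2 = "der_basis2 G :: ('v, 'e, 'k) path_op set"
  have indep: "op.independent (?B1 \<union> ?B2)" by (rule independent_der_basis)
  moreover have "op.span ?B1 \<inter> op.span ?B2 = {0}"
    by (rule op.span_Int_eq_zero[OF indep der_basis_disjoint])
  moreover have "op.independent ?B1" "op.independent ?B2"
    using op.independent_mono[OF indep] by auto
  ultimately show ?thesis
    \<comment> \<open>\<open>op.span_Un\<close> read backwards turns the set of sums into the span
      of the union, which \<open>span_der_basis\<close> identifies.\<close>
    by (simp add: is_basis_of_def is_direct_sum_def span_der_basis
        flip: op.span_Un)
qed

end
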